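(* Let $\mathcal{H}$ and $\mathcal{K}$ be real or complex Hilbert spaces, let $S$ be a linear operator from $\mathcal{H}$ to $\mathcal{K}$ and $T$ a linear operator from $\mathcal{K}$ to $\mathcal{H}$ (neither assumed densely defined, closed or bounded). The following statements are equivalent: (i) Both $S$ and $T$ are densely defined and $S=T^*$, $S^*=T$. (ii) $S\wedge T$ and $\operatorname{ran} M_{S,T}=\mathcal{H}\times\mathcal{K}$. (iii) $S\wedge T$, $\operatorname{ran}(I+ST)=\mathcal{K}$ and $\operatorname{ran}(I+TS)=\mathcal{H}$. (iv) $S\wedge T$, $G(S)^{\perp}\subseteq\operatorname{ran} M_{S,T}$ and $G(T)^{\perp}\subseteq\operatorname{ran} M_{T,S}$.
   Context: A linear operator from $\mathcal{H}$ to $\mathcal{K}$ is a linear map defined on a linear subspace $\operatorname{dom} S\subseteq\mathcal{H}$ with values in $\mathcal{K}$; equality of operators includes equality of domains, and products have their natural domains, e.g. $\operatorname{dom}(TS)=\{h\in\operatorname{dom}S: Sh\in\operatorname{dom}T\}$. $S\wedge T$ ("adjoint to each other") means $(Sh\mid k)=(h\mid Tk)$ for all $h\in\operatorname{dom}S$, $k\in\operatorname{dom}T$. $G(S)=\{(h,Sh): h\in\operatorname{dom}S\}\subseteq\mathcal{H}\times\mathcal{K}$ is the graph of $S$ and $G(T)\subseteq\mathcal{K}\times\mathcal{H}$ that of $T$; $\perp$ is taken in the corresponding product Hilbert space. $M_{S,T}$ is the operator in $\mathcal{H}\times\mathcal{K}$ with domain $\operatorname{dom}S\times\operatorname{dom}T$,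 $M_{S,T}(h,k)=(h-Tk,\,Sh+k)$; analogously $M_{T,S}$ acts in $\mathcal{K}\times\mathcal{H}$ with domain $\operatorname{dom}T\times\operatorname{dom}S$ by $M_{T,S}(k,h)=(k-Sh,\,Tk+h)$. *)

theory Defs
  imports "HOL-Analysis.Analysis"
begin

text \<open>
  The class of scalar fields has, up to isomorphism, exactly the members \<open>\<real>\<close> and \<open>\<complex>\<close>, with
  \<open>scnj\<close> the identity and complex conjugation, respectively; see \<open>real_or_complex_cases\<close> below.
\<close>

class real_or_complex = real_normed_field +
  fixes scnj :: "'a \<Rightarrow> 'a"
  assumes scnj_add: "scnj (x + y) = scnj x + scnj y"
    and mult_scnj_scaleR: "x * scnj x = (norm x)\<^sup>2 *\<^sub>R 1"

instantiation real :: real_or_complex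
begin
definition scnj_real :: "real \<Rightarrow> real" where "scnj_real x = x"
instance by standard (auto simp: scnj_real_def power2_eq_square)
end

instantiation complex :: real_or_complex
begin
definition scnj_complex :: "complex \<Rightarrow> complex" where "scnj_complex = cnj"
instance
  by standard (simp_all add: scnj_complex_def scaleR_conv_of_real flip: complex_norm_square)
end

lemma mult_scnj: "x * scnj x = of_real ((norm (x::'k::real_or_complex))\<^sup>2)"
  by (simp add: mult_scnj_scaleR of_real_def)

lemma scnj_eq_divide: "scnj (x::'k::real_or_complex) = of_real ((norm x)\<^sup>2) / x" if "x \<noteq> 0"
  using mult_scnj[of x] that by (simp add: field_simps)

lemma scnj_zero [simp]: "scnj (0::'k::real_or_complex) = 0"
  using scnj_add[of 0 "0::'k"] by simp

lemma scnj_minus: "scnj (- x) = - scnj (x::'k::real_or_complex)"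
  using scnj_add[of x "- x"] by (simp add: eq_neg_iff_add_eq_0 add.commute)

lemma scnj_mult: "scnj (x * y) = scnj x * scnj (y::'k::real_or_complex)"
  by (cases "x = 0 \<or> y = 0")
     (auto simp: scnj_eq_divide norm_mult power_mult_distrib)

lemma norm_scnj: "norm (scnj x) = norm (x::'k::real_or_complex)"
  by (cases "x = 0") (simp_all add: scnj_eq_divide norm_divide power2_eq_square 
      del: of_real_mult of_real_power)

lemma scnj_scnj: "scnj (scnj x) = (x::'k::real_or_complex)"
proof (cases "x = 0")
  case False
  then have "scnj x \<noteq> 0" using norm_scnj[of x] by auto
  with False show ?thesis
    using mult_scnj[of x] by (simp add: scnj_eq_divide[of "scnj x"] norm_scnj field_simps)
qed simp

lemma scnj_fixed_real:
  assumes "scnj x = (x::'k::real_or_complex)" shows "x \<in> \<real>"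
proof -
  have "x\<^sup>2 = (of_real (norm x))\<^sup>2" using mult_scnj[of x] assms by (simp add: power2_eq_square)
  then have "x = of_real (norm x) \<or> x = - of_real (norm x)" by (simp only: power2_eq_iff)
  then show ?thesis by (metis Reals_minus Reals_of_real)
qed

lemma real_or_complex_cases:
  "(\<forall>x::'k::real_or_complex. x \<in> \<real> \<and> scnj x = x) \<or>
   (\<exists>i::'k. i\<^sup>2 = - 1 \<and> scnj i = - i \<and> (\<forall>z. \<exists>a b. z = of_real a + of_real b * i))"
proof (cases "\<forall>x::'k. scnj x = x")
  case True
  then show ?thesis using scnj_fixed_real[where 'k = 'k] by (intro disjI1) simp
next
  case False
  then obtain x :: 'k where x: "scnj x \<noteq> x" by blast
  define y where "y = x - scnj x"
  have y0: "y \<noteq> 0" using x by (simp add: y_def)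
  have cy: "scnj y = - y"
    using scnj_add[of x "- scnj x"] by (simp add: y_def scnj_minus scnj_scnj)
  have creal: "scnj (of_real r) = (of_real r :: 'k)" for r
    by (cases "r = 0") (simp_all add: scnj_eq_divide power2_eq_square)
  define i where "i = y / of_real (norm y)"
  have ni: "norm i = 1" using y0 by (simp add: i_def norm_divide)
  have ci: "scnj i = - i"
    using scnj_mult[of "of_real (inverse (norm y))" y] creal[of "inverse (norm y)"]
    by (simp add: i_def cy divide_inverse mult.commute)
  have "- (i * i) = 1" using mult_scnj[of i] ni ci by simp
  then have i2: "i\<^sup>2 = - 1" by (metis minus_minus power2_eq_square)
  have "\<exists>a b. z = of_real a + of_real b * i" for z
  proof -
    have "scnj (z + scnj z) = z + scnj z" by (simp add: scnj_add scnj_scnj add.commute)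
    then obtain a where a: "z + scnj z = of_real a" using scnj_fixed_real Reals_cases by blast
    have d: "scnj (z - scnj z) = - (z - scnj z)"
      using scnj_add[of z "- scnj z"] by (simp add: scnj_minus scnj_scnj)
    have "scnj ((z - scnj z) * i) = (z - scnj z) * i"
      by (simp only: scnj_mult d ci minus_mult_minus)
    then obtain b where b: "(z - scnj z) * i = of_real b" using scnj_fixed_real Reals_cases by blast
    have "- (z - scnj z) = (z - scnj z) * i * i"
      unfolding mult.assoc power2_eq_square[symmetric] i2 by simp
    also have "\<dots> = of_real b * i" by (simp only: b)
    finally have "z - scnj z = - (of_real b * i)" by (simp only: minus_equation_iff[of "z - scnj z"])
    moreover have "2 * z = (z + scnj z) + (z - scnj z)" by simp
    ultimately have "2 * z = of_real a - of_real b * i" using a by simp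
    then have "z = of_real (a / 2) + of_real (- b / 2) * i"
      by (simp add: field_simps)
    then show ?thesis by blast
  qed
  with i2 ci show ?thesis by blast
qed

text \<open>
  Topology, norm and completeness are those of the type class \<^class>\<open>banach\<close>; the inner product
  \<open>ip\<close> is linear in the first argument and induces the norm. The norm of \<open>'a \<times> 'b\<close> in the library
  is the Euclidean one, so it is induced by \<open>prod_ip\<close> below.
\<close>

locale hilbert_space = vector_space scale
  for scale :: "'k::real_or_complex \<Rightarrow> 'a::banach \<Rightarrow> 'a" +
  fixes ip :: "'a \<Rightarrow> 'a \<Rightarrow> 'k"
  assumes scale_of_real: "scale (of_real r) x = r *\<^sub>R x"
    and ip_add_left: "ip (x + y) z = ip x z + ip y z"
    and ip_scale_left: "ip (scale c x) y = c * ip x y"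
    and ip_scnj: "ip y x = scnj (ip x y)"
    and ip_self: "ip x x = of_real ((norm x)\<^sup>2)"

lemma hilbert_space_real:
  "hilbert_space scaleR (inner :: 'a::{real_inner, banach} \<Rightarrow> 'a \<Rightarrow> real)"
  by unfold_locales
     (auto simp: algebra_simps inner_add_left scnj_real_def inner_commute power2_norm_eq_inner)

lemma hilbert_space_complex: "hilbert_space (*) (\<lambda>x y::complex. x * cnj y)"
  by unfold_locales
     (auto simp: algebra_simps scnj_complex_def scaleR_conv_of_real simp flip: complex_norm_square)

definition prod_ip ::
    "('a \<Rightarrow> 'a \<Rightarrow> 'k) \<Rightarrow> ('b \<Rightarrow> 'b \<Rightarrow> 'k) \<Rightarrow> 'a \<times> 'b \<Rightarrow> 'a \<times> 'b \<Rightarrow> 'k::plus" where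
  "prod_ip ipH ipK x y = ipH (fst x) (fst y) + ipK (snd x) (snd y)"

lemma hilbert_space_prod:
  assumes "hilbert_space sH ipH" and "hilbert_space sK ipK"
  shows "hilbert_space (\<lambda>c (x, y). (sH c x, sK c y)) (prod_ip ipH ipK)"
proof -
  interpret H: hilbert_space sH ipH by fact
  interpret K: hilbert_space sK ipK by fact
  show ?thesis
  proof unfold_locales
    fix x y :: "'b \<times> 'c"
    show "prod_ip ipH ipK y x = scnj (prod_ip ipH ipK x y)"
      using H.ip_scnj[of "fst y" "fst x"] K.ip_scnj[of "snd y" "snd x"]
      by (simp add: prod_ip_def scnj_add)
    show "prod_ip ipH ipK x x = of_real ((norm x)\<^sup>2)"
      by (simp add: prod_ip_def H.ip_self K.ip_self norm_prod_def)
  qed (auto simp: prod_ip_def H.scale_right_distrib K.scale_right_distrib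
        H.scale_left_distrib K.scale_left_distrib H.scale_of_real K.scale_of_real
        H.ip_add_left K.ip_add_left H.ip_scale_left K.ip_scale_left algebra_simps)
qed

definition orth_compl :: "('a \<Rightarrow> 'a \<Rightarrow> 'k::zero) \<Rightarrow> 'a set \<Rightarrow> 'a set" where
  "orth_compl ip A = {x. \<forall>y\<in>A. ip x y = 0}"

text \<open>
  Partially defined operators are partial functions \<open>'a \<rightharpoonup> 'b\<close>. Hence equality includes equality
  of domains, \<^const>\<open>map_comp\<close> is composition on the natural domain, and \<^const>\<open>Map.dom\<close>,
  \<^const>\<open>Map.ran\<close> and \<^const>\<open>Map.graph\<close> are domain, range and graph.
\<close>

definition linear_operator ::
    "('k::field \<Rightarrow> 'a::ab_group_add \<Rightarrow> 'a) \<Rightarrow> ('k \<Rightarrow> 'b::ab_group_add \<Rightarrow> 'b) \<Rightarrow> ('a \<rightharpoonup> 'b) \<Rightarrow> bool" where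
  "linear_operator sH sK S \<longleftrightarrow>
     module.subspace sH (dom S) \<and>
     (\<forall>x\<in>dom S. \<forall>y\<in>dom S. the (S (x + y)) = the (S x) + the (S y)) \<and>
     (\<forall>c. \<forall>x\<in>dom S. the (S (sH c x)) = sK c (the (S x)))"

definition densely_defined :: "('a::topological_space \<rightharpoonup> 'b) \<Rightarrow> bool" where
  "densely_defined S \<longleftrightarrow> closure (dom S) = UNIV"

definition adjoint_pair ::
    "('a \<Rightarrow> 'a \<Rightarrow> 'k) \<Rightarrow> ('b \<Rightarrow> 'b \<Rightarrow> 'k) \<Rightarrow> ('a \<rightharpoonup> 'b) \<Rightarrow> ('b \<rightharpoonup> 'a) \<Rightarrow> bool" where
  "adjoint_pair ipH ipK S T \<longleftrightarrow>
     (\<forall>h\<in>dom S. \<forall>k\<in>dom T. ipK (the (S h)) k = ipH h (the (T k)))"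

text \<open>
  The adjoint is meaningful only for densely defined operators: this is what makes the
  description \<open>THE z\<close> below unique.
\<close>

definition adj ::
    "('a \<Rightarrow> 'a \<Rightarrow> 'k) \<Rightarrow> ('b \<Rightarrow> 'b \<Rightarrow> 'k) \<Rightarrow> ('a \<rightharpoonup> 'b) \<Rightarrow> ('b \<rightharpoonup> 'a)" where
  "adj ipH ipK S = (\<lambda>k.
     if \<exists>z. \<forall>h\<in>dom S. ipK (the (S h)) k = ipH h z
     then Some (THE z. \<forall>h\<in>dom S. ipK (the (S h)) k = ipH h z)
     else None)"

definition op_add :: "('a \<rightharpoonup> 'b::plus) \<Rightarrow> ('a \<rightharpoonup> 'b) \<Rightarrow> ('a \<rightharpoonup> 'b)" where
  "op_add A B = (\<lambda>x. if x \<in> dom A \<inter> dom B then Some (the (A x) + the (B x)) else None)"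

abbreviation (input) op_id :: "'a \<rightharpoonup> 'a" where
  "op_id \<equiv> Some"

definition op_M ::
    "('a::ab_group_add \<rightharpoonup> 'b::ab_group_add) \<Rightarrow> ('b \<rightharpoonup> 'a) \<Rightarrow> ('a \<times> 'b \<rightharpoonup> 'a \<times> 'b)" where
  "op_M S T = (\<lambda>(h, k).
     if h \<in> dom S \<and> k \<in> dom T then Some (h - the (T k), the (S h) + k) else None)"

definition all_equivalent :: "bool list \<Rightarrow> bool" where
  "all_equivalent ps \<longleftrightarrow> (\<forall>p\<in>set ps. \<forall>q\<in>set ps. p \<longleftrightarrow> q)"

end

theory Submission
  imports Defs
begin

text \<open>
  Everything rests on \<open>G(S)\<^sup>\<bottom>\<close>. It contains the rotated graph \<open>{(-Tk, k)}\<close> exactly if \<open>S \<and> T\<close>,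
  and an element of \<open>ran M\<^sub>S\<^sub>,\<^sub>T\<close> is a sum \<open>(h, Sh) + (-Tk, k)\<close>. Hence under (i) the range is
  everything, by orthogonal projection onto the closed subspace \<open>G(S)\<close>, and under (iv) every element
  of \<open>G(S)\<^sup>\<bottom>\<close> is of the form \<open>(-Tk, k)\<close>, which gives both the density of \<open>dom S\<close> and
  \<open>S\<^sup>* = T\<close>. The equations for \<open>M\<^sub>S\<^sub>,\<^sub>T\<close> and for \<open>I + ST\<close>, \<open>I + TS\<close> are solved from each other by
  elimination.
\<close>

section \<open>Conjugation and the algebra of the inner product\<close>

lemma scnj_eq_0_iff [simp]: "scnj (x::'k::real_or_complex) = 0 \<longleftrightarrow> x = 0"
  using norm_scnj[of x] by (metis norm_eq_zero)

lemma scnj_eq_iff [simp]: "scnj (x::'k::real_or_complex) = scnj y \<longleftrightarrow> x = y"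
  by (metis scnj_scnj)

context hilbert_space
begin

lemma ip_zero_left [simp]: "ip 0 y = 0"
  using ip_add_left[of 0 0 y] by simp

lemma ip_minus_left: "ip (- x) y = - ip x y"
  using ip_add_left[of x "- x" y] by (simp add: eq_neg_iff_add_eq_0 add.commute)

lemma ip_diff_left: "ip (x - y) z = ip x z - ip y z"
  using ip_add_left[of x "- y" z] by (simp add: ip_minus_left)

lemma ip_add_right: "ip x (y + z) = ip x y + ip x z"
  by (metis ip_add_left ip_scnj scnj_add)

lemma ip_minus_right: "ip x (- y) = - ip x y"
  by (metis ip_minus_left ip_scnj scnj_minus)

lemma ip_diff_right: "ip x (y - z) = ip x y - ip x z"
  using ip_add_right[of x y "- z"] by (simp add: ip_minus_right)

lemma ip_scale_right: "ip x (scale c y) = scnj c * ip x y"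
  by (metis ip_scale_left ip_scnj scnj_mult)

lemma ip_eq_0_commute: "ip x y = 0 \<longleftrightarrow> ip y x = 0"
  using ip_scnj[of x y] by simp

lemma ip_self_eq_0_iff [simp]: "ip x x = 0 \<longleftrightarrow> x = 0"
  by (simp add: ip_self)

section \<open>Orthogonal projection and density\<close>

lemma parallelogram_law:
  fixes x y :: 'a
  shows
  "(norm (x + y))\<^sup>2 + (norm (x - y))\<^sup>2 = 2 * (norm x)\<^sup>2 + 2 * (norm y)\<^sup>2"
proof -
  have "ip (x + y) (x + y) + ip (x - y) (x - y) = 2 * ip x x + 2 * ip y y"
    by (simp add: ip_add_left ip_diff_left ip_add_right ip_diff_right)
  then have "of_real ((norm (x + y))\<^sup>2 + (norm (x - y))\<^sup>2) = (of_real (2 * (norm x)\<^sup>2 + 2 * (norm y)\<^sup>2) :: 'k)"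
    by (simp only: ip_self of_real_add of_real_mult of_real_numeral)
  then show ?thesis by (simp only: of_real_eq_iff)
qed

text \<open>Pythagoras for removing from \<open>x\<close> its component along \<open>y\<close>. It
  serves twice: nonnegativity of the left side is the Cauchy-Schwarz inequality, and minimality of a
  distance forces the subtracted term to vanish.\<close>

lemma norm_diff_projection:
  assumes "y \<noteq> 0"
  shows "(norm (x - scale (ip x y / ip y y) y))\<^sup>2 = (norm x)\<^sup>2 - (norm (ip x y))\<^sup>2 / (norm y)\<^sup>2"
proof -
  define c where "c = ip x y / ip y y"
  have yy: "ip y y \<noteq> 0" using assms by simp
  have c: "c * ip y y = ip x y" using yy by (simp add: c_def)
  have yx: "ip y x = scnj (ip x y)" by (rule ip_scnj)
  have "ip (x - scale c y) (x - scale c y)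
      = ip x x - c * ip y x - scnj c * (ip x y - c * ip y y)"
    by (simp add: ip_diff_left ip_diff_right ip_scale_left ip_scale_right algebra_simps)
  \<comment> \<open>The coefficient \<open>c\<close> is chosen so that the bracket after
    \<open>scnj c\<close> vanishes.\<close>
  also have "\<dots> = ip x x - ip x y * scnj (ip x y) / ip y y"
    by (simp only: c) (simp add: yx c_def)
  also have "\<dots> = of_real ((norm x)\<^sup>2 - (norm (ip x y))\<^sup>2 / (norm y)\<^sup>2)"
    by (simp only: mult_scnj ip_self of_real_diff of_real_divide)
  finally show ?thesis
    unfolding ip_self of_real_eq_iff c_def .
qed

lemma norm_ip_le: "norm (ip x y) \<le> norm x * norm y"
proof (cases "y = 0")
  case True
  then show ?thesis using ip_eq_0_commute[of x 0] by simp
next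
  case False
  have "0 \<le> (norm x)\<^sup>2 - (norm (ip x y))\<^sup>2 / (norm y)\<^sup>2"
    using norm_diff_projection[OF False, of x] by (metis zero_le_power2)
  then have "(norm (ip x y))\<^sup>2 \<le> (norm x * norm y)\<^sup>2"
    using False by (simp add: field_simps)
  then show ?thesis by (rule power2_le_imp_le) simp
qed

lemma bounded_linear_ip_left: "bounded_linear (\<lambda>x. ip x y)"
proof (rule bounded_linear_intro[where K = "norm y"])
  show "ip (r *\<^sub>R x) y = r *\<^sub>R ip x y" for r x
    unfolding scale_of_real[symmetric] ip_scale_left by (simp add: scaleR_conv_of_real)
qed (simp_all add: ip_add_left norm_ip_le)

text \<open>An intersection of kernels of continuous functionals. It yields the density criterion
  below, and later the closedness of the graph of \<open>S\<close>.\<close>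

lemma closed_orth_compl: "closed (orth_compl ip A)"
proof -
  have "orth_compl ip A = (\<Inter>y\<in>A. {x. ip x y = 0})" by (auto simp: orth_compl_def)
  moreover have "closed {x. ip x y = 0}" for y
    by (intro closed_Collect_eq linear_continuous_on bounded_linear_ip_left continuous_on_const)
  ultimately show ?thesis by auto
qed

text \<open>The points of \<open>C\<close> that almost realise the distance to \<open>x\<close> form
  decreasing closed sets. The parallelogram law makes their diameters tend to 0, so completeness
  provides a common point.\<close>

lemma exists_closest_point:
  fixes C :: "'a set"
  assumes "closed C" and "convex C" and "C \<noteq> {}"
  obtains v where "v \<in> C" and "\<And>y. y \<in> C \<Longrightarrow> norm (x - v) \<le> norm (x - y)"
proof -
  define d where "d = infdist x C"
  have d_le: "d \<le> norm (x - y)" if "y \<in> C" for y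
    using infdist_le[OF that, of x] by (simp add: d_def dist_norm)
  have d0: "0 \<le> d" by (simp add: d_def infdist_nonneg)
  define N where "N n = C \<inter> cball x (d + 1 / real (Suc n))" for n
  have "\<exists>v. \<forall>n. v \<in> N n"
  proof (rule decreasing_closed_nest[of N])
    show "closed (N n)" for n using assms(1) by (auto simp: N_def)
    show "N n \<noteq> {}" for n
    proof -
      have "infdist x C < d + 1 / real (Suc n)"
        by (simp add: d_def)
      then have "(INF y\<in>C. dist x y) < d + 1 / real (Suc n)"
        using assms(3) by (simp add: infdist_notempty)
      then obtain y where "y \<in> C" "dist x y < d + 1 / real (Suc n)"
        using cINF_greatest[OF assms(3), of "d + 1 / real (Suc n)" "dist x"] by (force simp: not_le)
      then show ?thesis by (auto simp: N_def)
    qed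
    show "N n \<subseteq> N m" if "m \<le> n" for m n
    proof -
      have "1 / real (Suc n) \<le> 1 / real (Suc m)" using that by (intro divide_left_mono) auto
      then show ?thesis by (auto simp: N_def)
    qed
    show "\<exists>n. \<forall>y\<in>N n. \<forall>z\<in>N n. dist y z < e" if "e > 0" for e
    proof -
      \<comment> \<open>By the parallelogram law, this expression bounds the squared distance of any
        two points of \<open>N n\<close>.\<close>
      have "(\<lambda>n. 4 * (d + 1 / real (Suc n))\<^sup>2 - 4 * d\<^sup>2) \<longlonglongrightarrow> 4 * (d + 0)\<^sup>2 - 4 * d\<^sup>2"
        by (intro tendsto_intros LIMSEQ_Suc[OF lim_1_over_n])
      then have "\<forall>\<^sub>F n in sequentially. 4 * (d + 1 / real (Suc n))\<^sup>2 - 4 * d\<^sup>2 < e\<^sup>2"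
        using that by (auto dest!: order_tendstoD(2)[of _ _ _ "e\<^sup>2"])
      then obtain n where n: "4 * (d + 1 / real (Suc n))\<^sup>2 - 4 * d\<^sup>2 < e\<^sup>2"
        by (auto simp: eventually_sequentially)
      have "dist y z < e" if "y \<in> N n" "z \<in> N n" for y z
      proof -
        \<comment> \<open>Convexity keeps the midpoint in \<open>C\<close>, hence at distance at
          least \<open>d\<close> from \<open>x\<close>. In the parallelogram law this bounds the sum
          term from below, and so the difference term \<open>dist y z\<close> from above.\<close>
        define m where "m = (1/2) *\<^sub>R y + (1/2) *\<^sub>R z"
        have "m \<in> C"
          unfolding m_def using assms(2) that by (intro convexD) (auto simp: N_def)
        then have "d\<^sup>2 \<le> (norm (x - m))\<^sup>2" using d_le d0 by (intro power_mono) auto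
        moreover have "(norm ((x - y) + (x - z)))\<^sup>2 = 4 * (norm (x - m))\<^sup>2"
        proof -
          have "(x - y) + (x - z) = 2 *\<^sub>R (x - m)"
            by (simp add: m_def algebra_simps scaleR_2)
          then show ?thesis by (simp only: norm_scaleR power_mult_distrib) simp
        qed
        moreover have "(norm (x - y))\<^sup>2 \<le> (d + 1 / real (Suc n))\<^sup>2" "(norm (x - z))\<^sup>2 \<le> (d + 1 / real (Suc n))\<^sup>2"
          using that by (auto simp: N_def dist_norm intro!: power_mono)
        moreover have "norm ((x - y) - (x - z)) = dist y z"
          by (simp add: dist_norm norm_minus_commute)
        ultimately have "(dist y z)\<^sup>2 < e\<^sup>2"
          using parallelogram_law[of "x - y" "x - z"] n by simp
        then show ?thesis using \<open>e > 0\<close> by (rule power2_less_imp_less[OF _ less_imp_le])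
      qed
      then show ?thesis by blast
    qed
    show "\<exists>v. \<forall>n. v \<in> N n" if "\<And>n. v \<in> N n" for v using that by blast
  qed
  then obtain v where v: "v \<in> N n" for n by blast
  have "norm (x - v) \<le> d + 0"
  proof (rule LIMSEQ_le_const)
    show "(\<lambda>n. d + 1 / real (Suc n)) \<longlonglongrightarrow> d + 0"
      by (intro tendsto_intros LIMSEQ_Suc[OF lim_1_over_n])
    show "\<exists>N. \<forall>n\<ge>N. norm (x - v) \<le> d + 1 / real (Suc n)"
      using v by (auto simp: N_def dist_norm)
  qed
  moreover have "v \<in> C" using v[of 0] by (simp add: N_def)
  ultimately show thesis using d_le by (intro that[of v]) fastforce+
qed

lemma convex_subspace: "subspace V \<Longrightarrow> convex V"
  unfolding convex_def scale_of_real[symmetric] by (simp add: subspace_add subspace_scale)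

text \<open>Let \<open>v\<close> be the point of \<open>closure V\<close> closest to
  \<open>x\<close>. Subtracting from \<open>x - v\<close> its component along a vector of
  \<open>V\<close> cannot shorten it, so that component is zero.\<close>

lemma orthogonal_decomposition:
  assumes V: "subspace V"
  obtains v w where "x = v + w" and "v \<in> closure V" and "w \<in> orth_compl ip V"
proof -
  have "closure V \<noteq> {}" using subspace_0[OF V] closure_subset by blast
  then obtain v where v: "v \<in> closure V"
    and min: "\<And>y. y \<in> closure V \<Longrightarrow> norm (x - v) \<le> norm (x - y)"
    using exists_closest_point[of "closure V" x] convex_closure[OF convex_subspace[OF V]] by auto
  have "ip (x - v) y = 0" if y: "y \<in> V" for y
  proof (cases "y = 0")
    case True
    then show ?thesis using ip_eq_0_commute[of "x - v" 0] by simp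
  next
    case False
    define z where "z = scale (ip (x - v) y / ip y y) y"
    \<comment> \<open>Translation by \<open>z\<close> preserves \<open>V\<close> and therefore its
      closure, so \<open>z + v\<close> is a competitor of the closest point
      \<open>v\<close>.\<close>
    have "(+) z ` V \<subseteq> V" using V y by (auto simp: z_def subspace_add subspace_scale)
    then have "closure ((+) z ` V) \<subseteq> closure V" by (rule closure_mono)
    then have "z + v \<in> closure V" using v by (auto simp: closure_translation)
    then have "norm (x - v) \<le> norm (x - (z + v))" by (rule min)
    then have "norm (x - v) \<le> norm (x - v - z)" by (simp add: algebra_simps)
    then have "(norm (x - v))\<^sup>2 \<le> (norm (x - v - z))\<^sup>2" by (rule power_mono) simp
    then have "(norm (ip (x - v) y))\<^sup>2 / (norm y)\<^sup>2 \<le> 0"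
      using norm_diff_projection[OF False, of "x - v"] by (simp add: z_def)
    then show ?thesis using False by (simp add: divide_le_0_iff)
  qed
  then show thesis using v by (intro that[of v "x - v"]) (auto simp: orth_compl_def)
qed

lemma dense_subspace_iff:
  assumes "subspace V"
  shows "closure V = UNIV \<longleftrightarrow> orth_compl ip V = {0}"
proof
  assume dense: "closure V = UNIV"
  have "w = 0" if w: "w \<in> orth_compl ip V" for w
  proof -
    \<comment> \<open>A vector orthogonal to a dense set is orthogonal to everything, in particular
      to itself.\<close>
    have "V \<subseteq> orth_compl ip {w}"
      using w ip_eq_0_commute by (auto simp: orth_compl_def)
    then have "closure V \<subseteq> orth_compl ip {w}" by (intro closure_minimal closed_orth_compl)
    then have "w \<in> orth_compl ip {w}" using dense by auto
    then show ?thesis by (simp add: orth_compl_def)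
  qed
  then show "orth_compl ip V = {0}" by (auto simp: orth_compl_def)
next
  assume "orth_compl ip V = {0}"
  then show "closure V = UNIV"
    using orthogonal_decomposition[OF assms] by (metis UNIV_eq_I add.right_neutral singletonD)
qed

end

section \<open>Pairs of linear operators, their graphs and adjoints\<close>

locale operator_pair =
  H: hilbert_space scaleH ipH + K: hilbert_space scaleK ipK
  for scaleH :: "'k::real_or_complex \<Rightarrow> 'a::banach \<Rightarrow> 'a" and ipH :: "'a \<Rightarrow> 'a \<Rightarrow> 'k"
    and scaleK :: "'k \<Rightarrow> 'b::banach \<Rightarrow> 'b" and ipK :: "'b \<Rightarrow> 'b \<Rightarrow> 'k" +
  fixes S :: "'a \<rightharpoonup> 'b" and T :: "'b \<rightharpoonup> 'a"
  assumes linS: "linear_operator scaleH scaleK S" and linT: "linear_operator scaleK scaleH T"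
begin

text \<open>The assumptions are symmetric in the two operators, so every fact of the locale is also
  available with the roles of \<open>S\<close> and \<open>T\<close> exchanged.\<close>

lemma swap: "operator_pair scaleK ipK scaleH ipH T S"
  using linS linT by unfold_locales

lemma subspace_dom: "H.subspace (dom S)"
  using linS by (simp add: linear_operator_def)

lemma op_plus: "h \<in> dom S \<Longrightarrow> h' \<in> dom S \<Longrightarrow> h + h' \<in> dom S \<and> the (S (h + h')) = the (S h) + the (S h')"
  using linS H.subspace_add[OF subspace_dom] by (simp add: linear_operator_def)

lemma op_scale: "h \<in> dom S \<Longrightarrow> scaleH c h \<in> dom S \<and> the (S (scaleH c h)) = scaleK c (the (S h))"
  using linS H.subspace_scale[OF subspace_dom] by (simp add: linear_operator_def)

lemma op_minus: "h \<in> dom S \<Longrightarrow> - h \<in> dom S \<and> the (S (- h)) = - the (S h)"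
  using op_scale[of h "- 1"] by simp

lemma op_zero: "0 \<in> dom S" "the (S 0) = 0"
  using H.subspace_0[OF subspace_dom] op_scale[of 0 0] by auto

lemma op_diff: "h \<in> dom S \<Longrightarrow> h' \<in> dom S \<Longrightarrow> h - h' \<in> dom S \<and> the (S (h - h')) = the (S h) - the (S h')"
  using op_plus[of h "- h'"] op_minus[of h'] by simp

lemma mem_graph_iff: "p \<in> Map.graph S \<longleftrightarrow> fst p \<in> dom S \<and> snd p = the (S (fst p))"
  by (cases p) (auto simp: Map.graph_def)

lemma subspace_graph:
  "module.subspace (\<lambda>c (x, y). (scaleH c x, scaleK c y)) (Map.graph S)"
proof -
  interpret P: hilbert_space "\<lambda>c (x, y). (scaleH c x, scaleK c y)" "prod_ip ipH ipK"
    by (intro hilbert_space_prod H.hilbert_space_axioms K.hilbert_space_axioms)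
  show ?thesis
  proof (rule P.subspaceI)
    show "0 \<in> Map.graph S" using op_zero by (simp add: mem_graph_iff)
  next
    fix x y assume "x \<in> Map.graph S" "y \<in> Map.graph S"
    then show "x + y \<in> Map.graph S"
      using op_plus by (simp add: mem_graph_iff)
  next
    fix c x assume "x \<in> Map.graph S"
    then show "(case x of (x, y) \<Rightarrow> (scaleH c x, scaleK c y)) \<in> Map.graph S"
      using op_scale by (cases x) (simp add: mem_graph_iff)
  qed
qed

lemma mem_ran_op_M_iff:
  "(u, v) \<in> ran (op_M S T) \<longleftrightarrow>
     (\<exists>h\<in>dom S. \<exists>k\<in>dom T. u = h - the (T k) \<and> v = the (S h) + k)"
  unfolding ran_def op_M_def by (auto split: if_splits)

lemma mem_ran_id_plus_iff:
  "v \<in> ran (op_add op_id (S \<circ>\<^sub>m T)) \<longleftrightarrow>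
     (\<exists>k\<in>dom T. the (T k) \<in> dom S \<and> v = k + the (S (the (T k))))"
proof -
  have "op_add op_id (S \<circ>\<^sub>m T) k = Some v \<longleftrightarrow> k \<in> dom T \<and> the (T k) \<in> dom S \<and> v = k + the (S (the (T k)))" for k
    by (cases "T k") (auto simp: op_add_def map_comp_def dom_def)
  then show ?thesis by (auto simp: ran_def simp del: not_None_eq)
qed

lemma mem_orth_compl_graph_iff:
  "(u, v) \<in> orth_compl (prod_ip ipH ipK) (Map.graph S) \<longleftrightarrow>
     (\<forall>h\<in>dom S. ipH u h + ipK v (the (S h)) = 0)"
  by (simp add: orth_compl_def prod_ip_def mem_graph_iff split_paired_all Ball_def)

text \<open>Conjugate symmetry turns orthogonality to the graph into the defining equation of the
  adjoint. Formulated with this equation instead of \<open>adj\<close>, it can be applied before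
  \<open>dom S\<close> is known to be dense.\<close>

lemma orth_compl_graph_iff_adjoint:
  "(- u, v) \<in> orth_compl (prod_ip ipH ipK) (Map.graph S) \<longleftrightarrow>
     (\<forall>h\<in>dom S. ipK (the (S h)) v = ipH h u)"
proof -
  have "ipH (- u) h + ipK v y = 0 \<longleftrightarrow> ipK y v = ipH h u" for h y
    unfolding H.ip_scnj[where x = u and y = h] K.ip_scnj[where x = v and y = y]
    by (auto simp: H.ip_minus_left)
  then show ?thesis by (simp add: mem_orth_compl_graph_iff)
qed

text \<open>Two candidates for the value of the adjoint differ by a vector orthogonal to
  \<open>dom S\<close>. By density this difference is 0, so the description in \<open>adj\<close>
  picks the only candidate.\<close>

lemma adj_eq_Some_iff:
  assumes "densely_defined S"
  shows "adj ipH ipK S k = Some z \<longleftrightarrow> (\<forall>h\<in>dom S. ipK (the (S h)) k = ipH h z)"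
proof -
  have uniq: "z = z'" if "\<forall>h\<in>dom S. ipK (the (S h)) k = ipH h z" "\<forall>h\<in>dom S. ipK (the (S h)) k = ipH h z'"
    for z z'
  proof -
    have "ipH (z - z') h = 0" if "h \<in> dom S" for h
      using \<open>\<forall>h\<in>dom S. ipK (the (S h)) k = ipH h z\<close> \<open>\<forall>h\<in>dom S. ipK (the (S h)) k = ipH h z'\<close> that
      by (subst H.ip_eq_0_commute) (simp add: H.ip_diff_right)
    then have "z - z' \<in> orth_compl ipH (dom S)" by (simp add: orth_compl_def)
    then show ?thesis
      using assms H.dense_subspace_iff[OF subspace_dom] by (simp add: densely_defined_def)
  qed
  show ?thesis
  proof
    assume "adj ipH ipK S k = Some z"
    then obtain z' where z': "\<forall>h\<in>dom S. ipK (the (S h)) k = ipH h z'"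
      and z: "z = (THE z. \<forall>h\<in>dom S. ipK (the (S h)) k = ipH h z)"
      unfolding adj_def by (auto split: if_splits)
    have "z = z'" unfolding z by (rule the_equality[where P = "\<lambda>z. \<forall>h\<in>dom S. ipK (the (S h)) k = ipH h z", OF z' uniq[OF _ z']])
    then show "\<forall>h\<in>dom S. ipK (the (S h)) k = ipH h z" using z' by (simp only:)
  next
    assume z: "\<forall>h\<in>dom S. ipK (the (S h)) k = ipH h z"
    then have "(THE z. \<forall>h\<in>dom S. ipK (the (S h)) k = ipH h z) = z"
      by (rule the_equality[where P = "\<lambda>z. \<forall>h\<in>dom S. ipK (the (S h)) k = ipH h z", OF _ uniq[OF _ z]])
    with z show "adj ipH ipK S k = Some z" unfolding adj_def by metis
  qed
qed

section \<open>The implications between the four conditions\<close>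

lemma adjoint_pair_commute: "adjoint_pair ipK ipH T S \<longleftrightarrow> adjoint_pair ipH ipK S T"
proof -
  have "ipH z h = ipK k y \<longleftrightarrow> ipK y k = ipH h z" for h z k y
    unfolding H.ip_scnj[where x = h and y = z] K.ip_scnj[where x = y and y = k] by auto
  then show ?thesis unfolding adjoint_pair_def by blast
qed

text \<open>Decompose \<open>(u, v)\<close> orthogonally along the graph of \<open>S\<close>. The
  projection has the form \<open>(a, S a)\<close> because the graph is closed, the remainder has the
  form \<open>(- T d, d)\<close> because \<open>T\<close> is the adjoint of \<open>S\<close>, and
  their sum is the image of \<open>(a, d)\<close>.\<close>

lemma ran_op_M_if_adjoint:
  assumes dS: "densely_defined S" and dT: "densely_defined T"
    and S: "S = adj ipK ipH T" and T: "adj ipH ipK S = T"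
  shows "adjoint_pair ipH ipK S T \<and> ran (op_M S T) = UNIV"
proof -
  interpret TS: operator_pair scaleK ipK scaleH ipH T S by (rule swap)
  interpret P: hilbert_space "\<lambda>c (x, y). (scaleH c x, scaleK c y)" "prod_ip ipH ipK"
    by (intro hilbert_space_prod H.hilbert_space_axioms K.hilbert_space_axioms)
  have T_iff: "T k = Some z \<longleftrightarrow> (\<forall>h\<in>dom S. ipK (the (S h)) k = ipH h z)" for k z
    using adj_eq_Some_iff[OF dS] unfolding T .
  have S_iff: "S h = Some y \<longleftrightarrow> (\<forall>k\<in>dom T. ipH (the (T k)) h = ipK k y)" for h y
    using TS.adj_eq_Some_iff[OF dT] unfolding S[symmetric] .
  have pair: "adjoint_pair ipH ipK S T"
    unfolding adjoint_pair_def using T_iff by fastforce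
  have "(u, v) \<in> ran (op_M S T)" for u v
  proof -
    obtain p q where pq: "(u, v) = p + q" and p: "p \<in> closure (Map.graph S)"
      and q: "q \<in> orth_compl (prod_ip ipH ipK) (Map.graph S)"
      using P.orthogonal_decomposition[OF subspace_graph] .
    obtain a b where ab: "p = (a, b)" by fastforce
    obtain c d where cd: "q = (c, d)" by fastforce
    have "T d = Some (- c)"
      using q orth_compl_graph_iff_adjoint[of "- c" d] by (simp add: cd T_iff)
    moreover have "S a = Some b"
    proof -
      \<comment> \<open>The decomposition places \<open>p\<close> only in the closure of the graph.
        Since \<open>S\<close> is the adjoint of \<open>T\<close>, its graph is the orthogonal
        complement of the rotated graph \<open>R\<close> of \<open>T\<close>, hence closed.\<close>
      define R where "R = (\<lambda>k. (- the (T k), k)) ` dom T"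
      have R: "(x, y) \<in> orth_compl (prod_ip ipH ipK) R \<longleftrightarrow> S x = Some y" for x y
      proof -
        have "ipH x (- z) + ipK y k = 0 \<longleftrightarrow> ipH z x = ipK k y" for z k
          unfolding H.ip_scnj[where x = x and y = z] K.ip_scnj[where x = y and y = k]
          by (auto simp: H.ip_minus_right)
        then show ?thesis by (simp add: R_def orth_compl_def prod_ip_def S_iff)
      qed
      have "Map.graph S \<subseteq> orth_compl (prod_ip ipH ipK) R"
        using R by (auto simp: Map.graph_def)
      then have "closure (Map.graph S) \<subseteq> orth_compl (prod_ip ipH ipK) R"
        by (intro closure_minimal P.closed_orth_compl)
      then show ?thesis using p R ab by auto
    qed
    ultimately show ?thesis
      unfolding mem_ran_op_M_iff using pq
      by (intro bexI[of _ a] bexI[of _ d]) (auto simp: ab cd)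
  qed
  with pair show ?thesis by auto
qed

lemma ran_id_plus_if_ran_op_M:
  assumes "ran (op_M S T) = UNIV"
  shows "ran (op_add op_id (S \<circ>\<^sub>m T)) = UNIV"
proof -
  have "v \<in> ran (op_add op_id (S \<circ>\<^sub>m T))" for v
  proof -
    \<comment> \<open>A zero first component forces \<open>h = T k\<close>, which turns the second
      component into \<open>S (T k) + k\<close>.\<close>
    have "(0, v) \<in> ran (op_M S T)" using assms by simp
    then obtain h k where "h \<in> dom S" "k \<in> dom T" "0 = h - the (T k)" "v = the (S h) + k"
      unfolding mem_ran_op_M_iff by blast
    then show ?thesis unfolding mem_ran_id_plus_iff by (auto simp: add.commute)
  qed
  then show ?thesis by auto
qed

text \<open>The two operators agree up to exchanging coordinates and signs: a solution
  \<open>(h, k)\<close> for the right side \<open>(u, - v)\<close> gives the solution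
  \<open>(- k, h)\<close> for \<open>(v, u)\<close>.\<close>

lemma ran_op_M_swap:
  assumes "ran (op_M S T) = UNIV"
  shows "ran (op_M T S) = UNIV"
proof -
  interpret TS: operator_pair scaleK ipK scaleH ipH T S by (rule swap)
  have "(v, u) \<in> ran (op_M T S)" for u v
  proof -
    have "(u, - v) \<in> ran (op_M S T)" using assms by simp
    then obtain h k where hk: "h \<in> dom S" "k \<in> dom T" "u = h - the (T k)" "- v = the (S h) + k"
      unfolding mem_ran_op_M_iff by blast
    have "v = - k - the (S h)" using hk(4) by (metis minus_add_distrib minus_minus add.commute diff_conv_add_uminus)
    then show ?thesis
      unfolding TS.mem_ran_op_M_iff using hk TS.op_minus[of k]
      by (intro bexI[of _ "- k"] bexI[of _ h]) auto
  qed
  then show ?thesis by auto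
qed

text \<open>By linearity it suffices to reach \<open>(u, 0)\<close> and \<open>(0, v)\<close>. If
  \<open>h + T (S h) = u\<close>, the pair \<open>(h, - S h)\<close> is mapped to the former; if
  \<open>k + S (T k) = v\<close>, the pair \<open>(T k, k)\<close> is mapped to the latter. The
  witnesses at the end are the sum of these two pairs.\<close>

lemma ran_op_M_if_ran_id_plus:
  assumes "ran (op_add op_id (S \<circ>\<^sub>m T)) = UNIV" and "ran (op_add op_id (T \<circ>\<^sub>m S)) = UNIV"
  shows "ran (op_M S T) = UNIV"
proof -
  interpret TS: operator_pair scaleK ipK scaleH ipH T S by (rule swap)
  have "(u, v) \<in> ran (op_M S T)" for u v
  proof -
    have "v \<in> ran (op_add op_id (S \<circ>\<^sub>m T))" "u \<in> ran (op_add op_id (T \<circ>\<^sub>m S))"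
      using assms by simp_all
    then obtain h k where k: "k \<in> dom T" "the (T k) \<in> dom S" "v = k + the (S (the (T k)))"
      and h: "h \<in> dom S" "the (S h) \<in> dom T" "u = h + the (T (the (S h)))"
      unfolding mem_ran_id_plus_iff TS.mem_ran_id_plus_iff by blast
    have "h + the (T k) \<in> dom S" "the (S (h + the (T k))) = the (S h) + the (S (the (T k)))"
      using op_plus[OF h(1) k(2)] by simp_all
    moreover have "k - the (S h) \<in> dom T" "the (T (k - the (S h))) = the (T k) - the (T (the (S h)))"
      using TS.op_diff[OF k(1) h(2)] by simp_all
    ultimately show ?thesis
      unfolding mem_ran_op_M_iff using h(3) k(3)
      by (intro bexI[of _ "h + the (T k)"] bexI[of _ "k - the (S h)"]) simp_all
  qed
  then show ?thesis by auto
qed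

text \<open>Every element of the orthogonal complement of the graph turns out to be
  \<open>(- T k, k)\<close> for some \<open>k\<close> in \<open>dom T\<close>. Elements
  \<open>(w, 0)\<close> then give density of \<open>dom S\<close>, and elements
  \<open>(- z, k)\<close> identify the adjoint with \<open>T\<close>.\<close>

lemma adjoint_if_orth_compl_graph:
  assumes pair: "adjoint_pair ipH ipK S T"
    and sub: "orth_compl (prod_ip ipH ipK) (Map.graph S) \<subseteq> ran (op_M S T)"
  shows "densely_defined S \<and> adj ipH ipK S = T"
proof -
  interpret P: hilbert_space "\<lambda>c (x, y). (scaleH c x, scaleK c y)" "prod_ip ipH ipK"
    by (intro hilbert_space_prod H.hilbert_space_axioms K.hilbert_space_axioms)
  have T_graph: "k \<in> dom T \<and> the (T k) = - u"
    if uk: "(u, k) \<in> orth_compl (prod_ip ipH ipK) (Map.graph S)" for u k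
  proof -
    obtain h k' where hk: "h \<in> dom S" "k' \<in> dom T" "u = h - the (T k')" "k = the (S h) + k'"
      using sub uk mem_ran_op_M_iff by blast
    \<comment> \<open>By adjointness \<open>(- T k', k')\<close> is orthogonal to the graph, as is
      \<open>(u, k)\<close>. Their difference \<open>(h, S h)\<close> lies in the graph as well, so
      it is orthogonal to itself and vanishes.\<close>
    have "(- the (T k'), k') \<in> orth_compl (prod_ip ipH ipK) (Map.graph S)"
      using pair hk by (simp add: orth_compl_graph_iff_adjoint adjoint_pair_def)
    then have "ipH (- the (T k')) h + ipK k' (the (S h)) = 0" "ipH u h + ipK k (the (S h)) = 0"
      using hk(1) uk by (auto simp: mem_orth_compl_graph_iff)
    then have "ipH h h + ipK (the (S h)) (the (S h)) = 0"
      by (simp add: hk(3,4) H.ip_diff_left H.ip_minus_left K.ip_add_left algebra_simps)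
    then have "prod_ip ipH ipK (h, the (S h)) (h, the (S h)) = 0" by (simp add: prod_ip_def)
    then have "(h, the (S h)) = 0" using P.ip_self_eq_0_iff by blast
    then have "h = 0" "the (S h) = 0" by (auto simp: zero_prod_def)
    then show ?thesis using hk by auto
  qed
  have "w = 0" if "w \<in> orth_compl ipH (dom S)" for w
  proof -
    \<comment> \<open>Orthogonality to \<open>dom S\<close> is orthogonality of
      \<open>(w, 0)\<close> to the graph, and then \<open>w = - T 0 = 0\<close>.\<close>
    have "(w, 0) \<in> orth_compl (prod_ip ipH ipK) (Map.graph S)"
      using that unfolding mem_orth_compl_graph_iff by (simp add: orth_compl_def)
    then have "the (T 0) = - w" using T_graph by blast
    then show ?thesis using operator_pair.op_zero(2)[OF swap] by simp
  qed
  then have dense: "densely_defined S"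
    unfolding densely_defined_def H.dense_subspace_iff[OF subspace_dom]
    by (auto simp: orth_compl_def)
  have "adj ipH ipK S k = Some z \<longleftrightarrow> T k = Some z" for k z
  proof
    assume "adj ipH ipK S k = Some z"
    then have "(- z, k) \<in> orth_compl (prod_ip ipH ipK) (Map.graph S)"
      by (simp add: adj_eq_Some_iff[OF dense] orth_compl_graph_iff_adjoint)
    then show "T k = Some z" using T_graph by fastforce
  next
    assume "T k = Some z"
    then show "adj ipH ipK S k = Some z"
      using pair unfolding adj_eq_Some_iff[OF dense] adjoint_pair_def by (metis domI option.sel)
  qed
  then have "adj ipH ipK S = T" by (metis ext not_None_eq)
  with dense show ?thesis by simp
qed

end

text \<open>The second condition is the hub: it is equivalent to the third, and the first and fourth
  are tied to it by a cycle through \<open>q\<close>, \<open>s\<close> and \<open>p\<close>.\<close>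

lemma all_equivalent_4I:
  assumes "p \<Longrightarrow> q" "q \<Longrightarrow> r" "r \<Longrightarrow> q" "q \<Longrightarrow> s" "s \<Longrightarrow> p"
  shows "all_equivalent [p, q, r, s]"
  using assms unfolding all_equivalent_def list.set by blast

theorem theorem3p1:
  fixes scaleH :: "'k::real_or_complex \<Rightarrow> 'a::banach \<Rightarrow> 'a" and ipH :: "'a \<Rightarrow> 'a \<Rightarrow> 'k"
    and scaleK :: "'k \<Rightarrow> 'b::banach \<Rightarrow> 'b" and ipK :: "'b \<Rightarrow> 'b \<Rightarrow> 'k"
    and S :: "'a \<rightharpoonup> 'b" and T :: "'b \<rightharpoonup> 'a"
  assumes "hilbert_space scaleH ipH" and "hilbert_space scaleK ipK"
    and "linear_operator scaleH scaleK S" and "linear_operator scaleK scaleH T"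
  shows "all_equivalent
    [densely_defined S \<and> densely_defined T \<and> S = adj ipK ipH T \<and> adj ipH ipK S = T,
     adjoint_pair ipH ipK S T \<and> ran (op_M S T) = UNIV,
     adjoint_pair ipH ipK S T \<and>
       ran (op_add op_id (S \<circ>\<^sub>m T)) = UNIV \<and> ran (op_add op_id (T \<circ>\<^sub>m S)) = UNIV,
     adjoint_pair ipH ipK S T \<and>
       orth_compl (prod_ip ipH ipK) (Map.graph S) \<subseteq> ran (op_M S T) \<and>
       orth_compl (prod_ip ipK ipH) (Map.graph T) \<subseteq> ran (op_M T S)]"
    (is "all_equivalent [?i, ?ii, ?iii, ?iv]")
proof -
  interpret ST: operator_pair scaleH ipH scaleK ipK S T
    using assms by (simp add: operator_pair_def operator_pair_axioms_def)
  interpret TS: operator_pair scaleK ipK scaleH ipH T S by (rule ST.swap)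
  show ?thesis
  proof (rule all_equivalent_4I)
    show ?ii if ?i
      using that ST.ran_op_M_if_adjoint by blast
    show ?iii if ?ii
      using that ST.ran_id_plus_if_ran_op_M TS.ran_id_plus_if_ran_op_M[OF ST.ran_op_M_swap] by blast
    show ?ii if ?iii
      using that ST.ran_op_M_if_ran_id_plus by blast
    show ?iv if ?ii
      using that ST.ran_op_M_swap by blast
    \<comment> \<open>Each of the two inclusions gives density of one domain and one of the adjoint
      equations; adjointness is transferred to the exchanged pair by its symmetry.\<close>
    show ?i if ?iv
      using that ST.adjoint_if_orth_compl_graph TS.adjoint_if_orth_compl_graph
        ST.adjoint_pair_commute by simp
  qed
qed

end
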